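(* Every real symmetric $B_0$-tensor of even order $m$ and dimension $n$ has an SOS tensor decomposition.
   Context: A real tensor of order $m$ and dimension $n$ is an array $\mathcal{A}=(a_{i_1\cdots i_m})$ with $i_1,\dots,i_m\in[n]=\{1,\dots,n\}$; it is symmetric if its entries are invariant under permutations of the indices. Its associated form is $f_{\mathcal{A}}(\mathbf{x})=\mathcal{A}\mathbf{x}^m=\sum_{i_1,\dots,i_m\in[n]}a_{i_1\cdots i_m}x_{i_1}\cdots x_{i_m}$. For even $m$, $\mathcal{A}$ has an SOS tensor decomposition if $f_{\mathcal{A}}$ is a finite sum of squares of real polynomials. $\mathcal{A}$ is a $B_0$-tensor if for every $i\in[n]$, $\sum_{i_2,\dots,i_m=1}^n a_{ii_2\cdots i_m}\ge0$ and $\frac{1}{n^{m-1}}\sum_{i_2,\dots,i_m=1}^n a_{ii_2\cdots i_m}\ge a_{ij_2\cdots j_m}$ for all $(j_2,\dots,j_m)\ne(i,\dots,i)$. *)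

theory Defs
  imports "HOL-Analysis.Analysis" "HOL-Combinatorics.Permutations"
begin

text \<open>
  A tensor of order \<open>m\<close> and dimension \<open>n = CARD('n)\<close> is given by its entries, indexed by
  the lists in \<open>'n\<close> of length \<open>m\<close>. The values on lists of any other length are junk; every
  notion below takes the order \<open>m\<close> as a parameter and ignores them.
\<close>

type_synonym 'n tensor = "'n list \<Rightarrow> real"

definition symmetric_tensor :: "nat \<Rightarrow> 'n::finite tensor \<Rightarrow> bool" where
  "symmetric_tensor m A \<longleftrightarrow>
     (\<forall>is \<pi>. length is = m \<longrightarrow> \<pi> permutes {..<m} \<longrightarrow> A (permute_list \<pi> is) = A is)"

definition tensor_form :: "nat \<Rightarrow> 'n::finite tensor \<Rightarrow> real ^ 'n \<Rightarrow> real" where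
  "tensor_form m A x = (\<Sum>is | length is = m. A is * (\<Prod>k<m. x $ (is ! k)))"

text \<open>
  Polynomials are rendered as polynomial functions on \<open>\<real>\<^sup>n\<close>; since \<open>\<real>\<close> is infinite, these
  correspond one-to-one to formal polynomials in \<open>n\<close> variables.
\<close>

definition sum_of_squares :: "(real ^ 'n::finite \<Rightarrow> real) \<Rightarrow> bool" where
  "sum_of_squares f \<longleftrightarrow>
     (\<exists>(r::nat) p. (\<forall>j<r. real_polynomial_function (p j)) \<and> (\<forall>x. f x = (\<Sum>j<r. (p j x)\<^sup>2)))"

definition has_SOS_tensor_decomposition :: "nat \<Rightarrow> 'n::finite tensor \<Rightarrow> bool" where
  "has_SOS_tensor_decomposition m A \<longleftrightarrow> sum_of_squares (tensor_form m A)"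

definition row_sum :: "nat \<Rightarrow> 'n::finite tensor \<Rightarrow> 'n \<Rightarrow> real" where
  "row_sum m A i = (\<Sum>js | length js = m - 1. A (i # js))"

text \<open>Because of the truncated subtraction in \<open>m - 1\<close>, this is meaningful only for \<open>m > 0\<close>.\<close>

definition B0_tensor :: "nat \<Rightarrow> 'n::finite tensor \<Rightarrow> bool" where
  "B0_tensor m A \<longleftrightarrow>
     (\<forall>i. row_sum m A i \<ge> 0 \<and>
          (\<forall>js. length js = m - 1 \<longrightarrow> js \<noteq> replicate (m - 1) i \<longrightarrow>
                1 / real CARD('n) ^ (m - 1) * row_sum m A i \<ge> A (i # js)))"

end

theory Submission
  imports Defs
begin

text \<open>
  Let \<open>\<beta> i\<close> be the larger of \<open>0\<close> and the largest off-diagonal entry of row \<open>i\<close>.  Subtract from the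
  tensor the tensor with entries \<open>min\<^sub>k \<beta> (i\<^sub>k)\<close>.  Symmetry makes the off-diagonal entries of
  the difference nonpositive, and the \<open>B\<^sub>0\<close> condition makes its row sums nonnegative; such a tensor is
  a nonnegative combination of the powers \<open>x\<^sub>i\<^sup>m\<close> and the arithmetic-geometric mean forms
  \<open>\<Sum>\<^sub>k x\<^bsub>i\<^sub>k\<^esub>\<^sup>m - m \<Prod>\<^sub>k x\<^bsub>i\<^sub>k\<^esub>\<close>, which are sums of squares by a theorem of Hurwitz.  The subtracted part
  is a nonnegative combination of the forms \<open>(\<Sum>\<^sub>j\<^sub>\<in>\<^sub>J x\<^sub>j)\<^sup>m\<close>, where \<open>J\<close> runs through the superlevel
  sets of \<open>\<beta>\<close>.
\<close>

section \<open>Closure properties of sums of squares\<close>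

lemma sum_of_squares_square:
  assumes "real_polynomial_function p"
  shows "sum_of_squares (\<lambda>x. (p x)\<^sup>2)"
  unfolding sum_of_squares_def
  by (rule exI[of _ 1], rule exI[of _ "\<lambda>_. p"]) (use assms in auto)

lemma sum_of_squares_zero: "sum_of_squares (\<lambda>x. 0)"
  unfolding sum_of_squares_def by (rule exI[of _ 0]) auto

lemma sum_of_squares_add:
  assumes "sum_of_squares f" "sum_of_squares g"
  shows "sum_of_squares (\<lambda>x. f x + g x)"
proof -
  obtain r :: nat and p where p: "\<forall>j<r. real_polynomial_function (p j)"
    "\<forall>x. f x = (\<Sum>j<r. (p j x)\<^sup>2)"
    using assms(1) unfolding sum_of_squares_def by blast
  obtain s :: nat and q where q: "\<forall>j<s. real_polynomial_function (q j)"
    "\<forall>x. g x = (\<Sum>j<s. (q j x)\<^sup>2)"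
    using assms(2) unfolding sum_of_squares_def by blast
  define u where "u = (\<lambda>j. if j < r then p j else q (j - r))"
  have "f x + g x = (\<Sum>j<r + s. (u j x)\<^sup>2)" for x
  proof -
    have "(\<Sum>j<r + t. (u j x)\<^sup>2) = (\<Sum>j<r. (p j x)\<^sup>2) + (\<Sum>j<t. (q j x)\<^sup>2)" for t
      by (induction t) (simp_all add: u_def)
    then show ?thesis by (simp add: p q)
  qed
  moreover have "\<forall>j<r + s. real_polynomial_function (u j)"
    using p q by (auto simp: u_def)
  ultimately show ?thesis unfolding sum_of_squares_def by blast
qed

lemma sum_of_squares_square_mult:
  assumes "real_polynomial_function q" "sum_of_squares f"
  shows "sum_of_squares (\<lambda>x. (q x)\<^sup>2 * f x)"
proof -
  obtain r :: nat and p where p: "\<forall>j<r. real_polynomial_function (p j)"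
    "\<forall>x. f x = (\<Sum>j<r. (p j x)\<^sup>2)"
    using assms(2) unfolding sum_of_squares_def by blast
  have "(q x)\<^sup>2 * f x = (\<Sum>j<r. (q x * p j x)\<^sup>2)" for x
    by (simp add: p sum_distrib_left power_mult_distrib)
  moreover have "\<forall>j<r. real_polynomial_function (\<lambda>x. q x * p j x)"
    using p assms(1) by (auto intro: real_polynomial_function.intros)
  ultimately show ?thesis
    unfolding sum_of_squares_def by (intro exI[of _ r] exI[of _ "\<lambda>j x. q x * p j x"]) blast
qed

lemma sum_of_squares_cmult:
  assumes "0 \<le> c" "sum_of_squares f"
  shows "sum_of_squares (\<lambda>x. c * f x)"
  using sum_of_squares_square_mult[OF real_polynomial_function.intros(2)[of "sqrt c"] assms(2)]
    assms(1) by simp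

lemma sum_of_squares_sum:
  assumes "finite I" "\<And>i. i \<in> I \<Longrightarrow> sum_of_squares (f i)"
  shows "sum_of_squares (\<lambda>x. \<Sum>i\<in>I. f i x)"
  using assms by (induction I) (auto intro: sum_of_squares_zero sum_of_squares_add)

lemma sum_of_squares_even_power:
  assumes "real_polynomial_function p" "even k"
  shows "sum_of_squares (\<lambda>x. p x ^ k)"
proof -
  obtain l where "k = l * 2" using assms(2) by (auto elim: evenE)
  then show ?thesis
    using sum_of_squares_square[OF real_polynomial_function_power[OF assms(1), of l]]
    by (simp add: power_mult)
qed

lemma real_polynomial_function_nth: "real_polynomial_function (\<lambda>x::real^'n. x $ i)"
  by (intro real_polynomial_function.intros(1) bounded_linear_vec_nth)

section \<open>Arithmetic-geometric mean forms\<close>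

text \<open>For \<open>a = (p x)^2\<close> and \<open>b = (q x)^2\<close>, the factor
  \<open>a - b\<close> divides \<open>a ^ k - b ^ k\<close> with a sum of products of squares as
  quotient. The whole is thus \<open>(a - b)^2\<close> times a sum of squares.\<close>

lemma sum_of_squares_power_diff:
  assumes p: "real_polynomial_function p" and q: "real_polynomial_function q"
  shows "sum_of_squares (\<lambda>x. ((p x)\<^sup>2 - (q x)\<^sup>2) * (((p x)\<^sup>2) ^ k - ((q x)\<^sup>2) ^ k))"
proof -
  have "sum_of_squares (\<lambda>x. \<Sum>i<k. ((p x)\<^sup>2 - (q x)\<^sup>2)\<^sup>2 * (q x ^ (k - Suc i) * p x ^ i)\<^sup>2)"
    by (intro sum_of_squares_sum sum_of_squares_square_mult sum_of_squares_square
        real_polynomial_function_diff real_polynomial_function_power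
        real_polynomial_function.intros p q finite_lessThan)
  moreover have "(a - b) * (a ^ k - b ^ k) = (\<Sum>i<k. (a - b)\<^sup>2 * (b ^ (k - Suc i) * a ^ i))"
    for a b :: real
    by (subst power_diff_sumr2) (simp add: power2_eq_square sum_distrib_left mult_ac)
  from this[of "(p _)\<^sup>2" "(q _)\<^sup>2"] have "((p x)\<^sup>2 - (q x)\<^sup>2) * (((p x)\<^sup>2) ^ k - ((q x)\<^sup>2) ^ k)
      = (\<Sum>i<k. ((p x)\<^sup>2 - (q x)\<^sup>2)\<^sup>2 * (q x ^ (k - Suc i) * p x ^ i)\<^sup>2)" for x
    by (simp add: power_mult_distrib mult.commute flip: power_mult)
  ultimately show ?thesis by simp
qed

text \<open>
  With \<open>z\<^sub>i = p\<^sub>i\<^sup>2\<close> and \<open>S\<^sub>l = \<Sum>\<^sub>i z\<^sub>i\<^sup>l\<close>, the induction step from \<open>k\<close> to \<open>k + 1\<close> adds the forms for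
  \<open>I - {j}\<close>, each multiplied by \<open>z\<^sub>j\<close>, to \<open>\<Sum>\<^sub>i\<^sub>,\<^sub>j (z\<^sub>i - z\<^sub>j) (z\<^sub>i\<^sup>k - z\<^sub>j\<^sup>k) / 2 = (k + 1) S\<^bsub>k+1\<^esub> - S\<^sub>1 S\<^sub>k\<close>.
\<close>

lemma sum_of_squares_am_gm_squares:
  assumes "finite I" "\<And>i. i \<in> I \<Longrightarrow> real_polynomial_function (p i)"
  shows "sum_of_squares (\<lambda>x. (\<Sum>i\<in>I. ((p i x)\<^sup>2) ^ card I) - real (card I) * (\<Prod>i\<in>I. (p i x)\<^sup>2))"
  using assms
proof (induction "card I" arbitrary: I)
  case 0
  then show ?case by (simp add: sum_of_squares_zero)
next
  case (Suc k)
  show ?case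
  proof (cases "k = 0")
    case True
    then obtain i where "I = {i}" using Suc.hyps by (metis One_nat_def card_1_singletonE)
    then show ?thesis by (simp add: sum_of_squares_zero)
  next
    case False
    define S where "S = (\<lambda>l x. \<Sum>i\<in>I. ((p i x)\<^sup>2) ^ l)"
    define P where "P = (\<lambda>x. \<Prod>i\<in>I. (p i x)\<^sup>2)"
    let ?f = "\<lambda>x. \<Sum>j\<in>I. (p j x)\<^sup>2 *
      ((\<Sum>i\<in>I - {j}. ((p i x)\<^sup>2) ^ card (I - {j}))
        - real (card (I - {j})) * (\<Prod>i\<in>I - {j}. (p i x)\<^sup>2))"
    let ?g = "\<lambda>x. \<Sum>i\<in>I. \<Sum>j\<in>I. ((p i x)\<^sup>2 - (p j x)\<^sup>2) * (((p i x)\<^sup>2) ^ k - ((p j x)\<^sup>2) ^ k)"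
    have "sum_of_squares ?f"
    proof (intro sum_of_squares_sum sum_of_squares_square_mult Suc.prems)
      fix j assume j: "j \<in> I"
      show "sum_of_squares (\<lambda>x. (\<Sum>i\<in>I - {j}. ((p i x)\<^sup>2) ^ card (I - {j}))
        - real (card (I - {j})) * (\<Prod>i\<in>I - {j}. (p i x)\<^sup>2))"
        using j Suc.hyps(2) Suc.prems by (intro Suc.hyps(1)) auto
    qed
    moreover have "sum_of_squares ?g"
      by (intro sum_of_squares_sum sum_of_squares_power_diff Suc.prems)
    \<comment> \<open>In \<open>?f + ?g / 2\<close> the mixed terms \<open>S 1 * S k\<close> cancel,
      leaving \<open>k\<close> times the target form. The division by \<open>k\<close> is why
      \<open>k = 0\<close> is a separate case.\<close>
    ultimately have "sum_of_squares (\<lambda>x. (1 / k) * (?f x + (1 / 2) * ?g x))"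
      by (intro sum_of_squares_cmult sum_of_squares_add) auto
    moreover have "(1 / k) * (?f x + (1 / 2) * ?g x) = S (Suc k) x - real (Suc k) * P x" for x
    proof -
      have "?f x = (\<Sum>j\<in>I. (p j x)\<^sup>2 * S k x - ((p j x)\<^sup>2) ^ Suc k - k * P x)"
      proof (rule sum.cong[OF refl])
        fix j assume j: "j \<in> I"
        have "card (I - {j}) = k" using j Suc by simp
        moreover have "(\<Sum>i\<in>I - {j}. ((p i x)\<^sup>2) ^ k) = S k x - ((p j x)\<^sup>2) ^ k"
          using j Suc.prems by (simp add: S_def sum_diff1)
        moreover have "P x = (p j x)\<^sup>2 * (\<Prod>i\<in>I - {j}. (p i x)\<^sup>2)"
          unfolding P_def using j Suc.prems by (intro prod.remove) auto
        ultimately show "(p j x)\<^sup>2 *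
            ((\<Sum>i\<in>I - {j}. ((p i x)\<^sup>2) ^ card (I - {j}))
              - real (card (I - {j})) * (\<Prod>i\<in>I - {j}. (p i x)\<^sup>2))
            = (p j x)\<^sup>2 * S k x - ((p j x)\<^sup>2) ^ Suc k - k * P x"
          by (simp add: right_diff_distrib)
      qed
      also have "\<dots> = S 1 x * S k x - S (Suc k) x - real (Suc k) * k * P x"
        using Suc.hyps(2) by (simp add: S_def sum_subtractf sum_distrib_right flip: Suc.hyps(2))
      finally have f: "?f x = S 1 x * S k x - S (Suc k) x - real (Suc k) * k * P x" .
      have "?g x = (\<Sum>i\<in>I. real (Suc k) * ((p i x)\<^sup>2) ^ Suc k - (p i x)\<^sup>2 * S k x
          - ((p i x)\<^sup>2) ^ k * S 1 x + S (Suc k) x)"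
        by (rule sum.cong[OF refl])
          (simp add: S_def algebra_simps sum_subtractf sum.distrib sum_distrib_left
            flip: Suc.hyps(2))
      also have "\<dots> = 2 * real (Suc k) * S (Suc k) x - 2 * S 1 x * S k x"
      proof -
        have "(\<Sum>i\<in>I. (p i x)\<^sup>2 * S k x) = S 1 x * S k x"
          "(\<Sum>i\<in>I. ((p i x)\<^sup>2) ^ k * S 1 x) = S k x * S 1 x"
          "(\<Sum>i\<in>I. real (Suc k) * ((p i x)\<^sup>2) ^ Suc k) = real (Suc k) * S (Suc k) x"
          by (simp_all add: S_def flip: sum_distrib_left sum_distrib_right)
        then show ?thesis
          by (simp only: sum_subtractf sum.distrib sum_constant flip: Suc.hyps(2)) simp
      qed
      finally have g: "?g x = 2 * real (Suc k) * S (Suc k) x - 2 * S 1 x * S k x" .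
      show ?thesis unfolding f g using False by (simp add: field_simps)
    qed
    ultimately show ?thesis
      using Suc.hyps(2) by (simp add: S_def P_def)
  qed
qed

text \<open>The \<open>p i\<close> may be negative, so they cannot stand for the squares in the
  previous lemma. Instead, each half of the \<open>m = 2 * k\<close> factors gives a form in the
  \<open>k\<close> squares \<open>(p i x)^2\<close>, whose \<open>k\<close>-th powers are the
  required \<open>m\<close>-th powers.\<close>

lemma sum_of_squares_am_gm:
  assumes "\<And>i. i < m \<Longrightarrow> real_polynomial_function (p i)" "even m"
  shows "sum_of_squares (\<lambda>x. (\<Sum>i<m. p i x ^ m) - real m * (\<Prod>i<m. p i x))"
proof -
  obtain k where m: "m = 2 * k" using assms(2) by (auto elim: evenE)
  have halves: "{..<m} = {..<k} \<union> {k..<m}" "{..<k} \<inter> {k..<m} = {}" using m by auto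
  define P where "P = (\<lambda>I x. \<Prod>i\<in>I. p i x)"
  let ?G = "\<lambda>I x. (\<Sum>i\<in>I. ((p i x)\<^sup>2) ^ card I) - real (card I) * (\<Prod>i\<in>I. (p i x)\<^sup>2)"
  have P: "real_polynomial_function (P I)" if "I \<subseteq> {..<m}" for I
    unfolding P_def using that assms(1)
    by (intro real_polynomial_function_prod) (auto intro: finite_subset)
  have "sum_of_squares (?G I)" if "I \<subseteq> {..<m}" for I
    using that assms(1) by (intro sum_of_squares_am_gm_squares) (auto intro: finite_subset)
  note G = this[of "{..<k}"] this[of "{k..<m}"]
  \<comment> \<open>Polarize the product: \<open>2 P Q = P\<^sup>2 + Q\<^sup>2 - (P - Q)\<^sup>2\<close> for its two halves \<open>P\<close> and \<open>Q\<close>.\<close>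
  have "sum_of_squares (\<lambda>x. ?G {..<k} x + (?G {k..<m} x + k * (P {..<k} x - P {k..<m} x)\<^sup>2))"
    by (intro sum_of_squares_add sum_of_squares_cmult sum_of_squares_square
        real_polynomial_function_diff P G) (auto simp: m)
  moreover have "(\<Sum>i<m. p i x ^ m) - real m * (\<Prod>i<m. p i x)
      = ?G {..<k} x + (?G {k..<m} x + k * (P {..<k} x - P {k..<m} x)\<^sup>2)" for x
    unfolding halves(1)
    by (subst sum.union_disjoint, simp, simp, rule halves(2),
        subst prod.union_disjoint, simp, simp, rule halves(2))
      (simp add: m P_def power_mult flip: prod_power_distrib, simp add: algebra_simps power2_diff)
  ultimately show ?thesis by simp
qed

section \<open>Sums over index lists and symmetry\<close>

lemma finite_lists_of_length: "finite {is :: 'n::finite list. length is = m}"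
  using finite_lists_length_eq[of "UNIV :: 'n set" m] by simp

lemma sum_lists_Suc:
  fixes g :: "'n::finite list \<Rightarrow> real"
  shows "(\<Sum>is | length is = Suc m. g is) = (\<Sum>i\<in>UNIV. \<Sum>js | length js = m. g (i # js))"
proof -
  have "(\<Sum>i\<in>UNIV. \<Sum>js | length js = m. g (i # js))
      = (\<Sum>(i, js)\<in>UNIV \<times> {js. length js = m}. g (i # js))"
    by (simp add: sum.cartesian_product)
  also have "\<dots> = (\<Sum>is | length is = Suc m. g is)"
    by (rule sum.reindex_bij_witness[of _ "\<lambda>is. (hd is, tl is)" "\<lambda>(i, js). i # js"])
      (auto simp: length_Suc_conv)
  finally show ?thesis ..
qed

lemma sum_lists_prod:
  fixes f :: "'n::finite \<Rightarrow> real"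
  shows "(\<Sum>is | length is = m. \<Prod>k<m. f (is ! k)) = (\<Sum>i\<in>UNIV. f i) ^ m"
proof (induction m)
  case (Suc m)
  show ?case
    by (simp add: sum_lists_Suc prod.lessThan_Suc_shift Suc.IH sum_distrib_right
        del: prod.lessThan_Suc flip: sum_distrib_left)
qed simp

lemma sum_permute_list:
  fixes g :: "'n::finite list \<Rightarrow> real"
  assumes \<pi>: "\<pi> permutes {..<m}"
  shows "(\<Sum>is | length is = m. g (permute_list \<pi> is)) = (\<Sum>is | length is = m. g is)"
proof (rule sum.reindex_bij_witness[of _ "permute_list (inv \<pi>)" "permute_list \<pi>"])
  fix "is" :: "'n list" assume "is \<in> {is. length is = m}"
  then show "permute_list (inv \<pi>) (permute_list \<pi> is) = is"
    "permute_list \<pi> (permute_list (inv \<pi>) is) = is"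
    using permutes_inv[OF \<pi>] \<pi>
    by (simp_all add: permutes_inv_o flip: permute_list_compose)
qed auto

text \<open>Rows are read off the first index; this swap carries facts about rows over to any
  position \<open>k\<close>.\<close>

lemma symmetric_tensor_first:
  assumes "symmetric_tensor m A" "length is = m" "k < m"
  shows "A (permute_list (Transposition.transpose 0 k) is) = A is"
    and "permute_list (Transposition.transpose 0 k) is ! 0 = is ! k"
proof -
  have "Transposition.transpose 0 k permutes {..<m}"
    using assms(3) by (intro permutes_swap_id) auto
  then show "A (permute_list (Transposition.transpose 0 k) is) = A is"
    and "permute_list (Transposition.transpose 0 k) is ! 0 = is ! k"
    using assms by (auto simp: symmetric_tensor_def permute_list_nth)
qed

text \<open>The swap reindexes the sum so that \<open>h\<close> sees the first index; grouping by
  that index produces the rows.\<close>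

lemma symmetric_tensor_sum_nth:
  assumes "symmetric_tensor m A" "k < m"
  shows "(\<Sum>is | length is = m. A is * h (is ! k)) = (\<Sum>i\<in>UNIV. row_sum m A i * h i)"
proof -
  have "Transposition.transpose 0 k permutes {..<m}"
    using assms(2) by (intro permutes_swap_id) auto
  from sum_permute_list[OF this, of "\<lambda>is. A is * h (is ! 0)"]
  have "(\<Sum>is | length is = m. A is * h (is ! k)) = (\<Sum>is | length is = m. A is * h (is ! 0))"
    using symmetric_tensor_first[OF assms(1) _ assms(2)] by simp
  also have "\<dots> = (\<Sum>i\<in>UNIV. row_sum m A i * h i)"
    using assms(2) sum_lists_Suc[of "\<lambda>is. A is * h (is ! 0)" "m - 1"]
    by (simp add: row_sum_def sum_distrib_right)
  finally show ?thesis .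
qed

section \<open>Tensors with nonpositive off-diagonal entries\<close>

text \<open>Each monomial is the mean of the \<open>m\<close>-th powers of its variables minus
  \<open>1 / m\<close> times its form \<open>?agm\<close>. By symmetry the means collect to
  \<open>?g\<close>, with the row sums as coefficients.\<close>

lemma sum_of_squares_Z_tensor:
  fixes A :: "'n::finite tensor"
  assumes "0 < m" "even m" and sym: "symmetric_tensor m A"
    and row: "\<And>i. 0 \<le> row_sum m A i"
    and off: "\<And>is. length is = m \<Longrightarrow> (\<And>i. is \<noteq> replicate m i) \<Longrightarrow> A is \<le> 0"
  shows "sum_of_squares (tensor_form m A)"
proof -
  let ?agm = "\<lambda>is x. (\<Sum>k<m. (x $ (is ! k)) ^ m) - real m * (\<Prod>k<m. x $ (is ! k))"
  let ?f = "\<lambda>x. \<Sum>is | length is = m. - A is * ?agm is x"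
  let ?g = "\<lambda>x. \<Sum>i\<in>UNIV. row_sum m A i * (x $ i) ^ m"
  have "sum_of_squares ?f"
  proof (intro sum_of_squares_sum finite_lists_of_length)
    fix "is" :: "'n list" assume "is \<in> {is. length is = m}"
    then have len: "length is = m" by simp
    show "sum_of_squares (\<lambda>x. - A is * ?agm is x)"
    proof (cases "\<exists>i. is = replicate m i")
      \<comment> \<open>On the diagonal \<open>?agm\<close> vanishes identically, whatever the sign
        of the entry.\<close>
      case True
      then show ?thesis
        using \<open>0 < m\<close> by (auto simp: sum_of_squares_zero)
    next
      case False
      then have "0 \<le> - A is" using off[OF len] by auto
      then show ?thesis
        using \<open>even m\<close>
        by (intro sum_of_squares_cmult sum_of_squares_am_gm real_polynomial_function_nth)
    qed
  qed
  moreover have "sum_of_squares ?g"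
    using \<open>even m\<close> row
    by (intro sum_of_squares_sum sum_of_squares_cmult sum_of_squares_even_power
        real_polynomial_function_nth) auto
  ultimately have "sum_of_squares (\<lambda>x. (1 / m) * ?f x + ?g x)"
    by (intro sum_of_squares_add sum_of_squares_cmult) auto
  moreover have "tensor_form m A x = (1 / m) * ?f x + ?g x" for x
  proof -
    have "(\<Sum>is | length is = m. A is * (\<Sum>k<m. (x $ (is ! k)) ^ m))
        = (\<Sum>k<m. \<Sum>is | length is = m. A is * (x $ (is ! k)) ^ m)"
      by (simp add: sum_distrib_left) (rule sum.swap)
    also have "\<dots> = m * ?g x"
      by (simp add: symmetric_tensor_sum_nth[OF sym, where h = "\<lambda>i. (x $ i) ^ m"])
    finally have "?f x = m * tensor_form m A x - m * ?g x"
      by (simp add: tensor_form_def algebra_simps sum.distrib sum_subtractf sum_negf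
          sum_distrib_left)
    then show ?thesis using \<open>0 < m\<close> by (simp add: field_simps)
  qed
  ultimately show ?thesis by presburger
qed

section \<open>Tensors of minima\<close>

lemma tensor_form_add:
  "tensor_form m (\<lambda>is. A is + B is) x = tensor_form m A x + tensor_form m B x"
  by (simp add: tensor_form_def distrib_right sum.distrib)

lemma tensor_form_cong:
  assumes "\<And>is. length is = m \<Longrightarrow> A is = B is"
  shows "tensor_form m A = tensor_form m B"
  using assms by (auto simp: tensor_form_def fun_eq_iff)

text \<open>Zeroing the coordinates outside \<open>J\<close>, as \<open>?y\<close> does, kills every
  monomial with an index outside \<open>J\<close>; what remains is an expanded \<open>m\<close>-th
  power.\<close>

lemma tensor_form_subset_indicator:
  "tensor_form m (\<lambda>is. if set is \<subseteq> J then h else 0) x = h * (\<Sum>j\<in>J. x $ j) ^ m"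
proof -
  let ?y = "\<lambda>i. if i \<in> J then x $ i else 0"
  have "(if set is \<subseteq> J then h else 0) * (\<Prod>k<m. x $ (is ! k)) = h * (\<Prod>k<m. ?y (is ! k))"
    if len: "length is = m" for "is"
  proof (cases "set is \<subseteq> J")
    case True
    then show ?thesis
      using len by (auto intro!: prod.cong simp: subset_iff)
  next
    case False
    then obtain k where "k < m" "is ! k \<notin> J"
      using len by (metis in_set_conv_nth subsetI)
    then show ?thesis using False by (auto intro!: prod_zero)
  qed
  then have "tensor_form m (\<lambda>is. if set is \<subseteq> J then h else 0) x = h * (\<Sum>i\<in>UNIV. ?y i) ^ m"
    by (simp add: tensor_form_def sum_distrib_left flip: sum_lists_prod)
  then show ?thesis by (simp add: sum.If_cases)
qed

text \<open>Layers are peeled off from below: lowering \<open>\<beta>\<close> by its least positive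
  value \<open>h\<close> on its support \<open>J\<close> removes \<open>h\<close> times an even
  power of a linear form.\<close>

lemma sum_of_squares_Min_tensor:
  fixes \<beta> :: "'n::finite \<Rightarrow> real"
  assumes "0 < m" "even m" "\<And>i. 0 \<le> \<beta> i"
  shows "sum_of_squares (tensor_form m (\<lambda>is. Min (\<beta> ` set is)))"
  using assms(3)
proof (induction "card {i. 0 < \<beta> i}" arbitrary: \<beta> rule: less_induct)
  case less
  define J where "J = {i. 0 < \<beta> i}"
  show ?case
  proof (cases "J = {}")
    case True
    then have "\<beta> i = 0" for i
      using less.prems[of i] by (auto simp: J_def less_le)
    then have "tensor_form m (\<lambda>is. Min (\<beta> ` set is)) = tensor_form m (\<lambda>is. 0)"
      using \<open>0 < m\<close> by (intro tensor_form_cong) (auto simp: image_constant_conv)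
    then show ?thesis by (simp add: tensor_form_def[abs_def] sum_of_squares_zero)
  next
    case False
    define h where "h = Min (\<beta> ` J)"
    have "h \<in> \<beta> ` J" unfolding h_def using False by (intro Min_in) auto
    then obtain j where j: "j \<in> J" "h = \<beta> j" by blast
    have h: "0 < h" "h \<le> \<beta> i" if "i \<in> J" for i
    proof -
      show "0 < h" using j by (simp add: J_def)
      show "h \<le> \<beta> i" unfolding h_def using that by (intro Min_le) auto
    qed
    have out: "\<beta> i = 0" if "i \<notin> J" for i
      using that less.prems[of i] by (auto simp: J_def)
    define \<gamma> where "\<gamma> = (\<lambda>i. if i \<in> J then \<beta> i - h else 0)"
    have nonneg: "0 \<le> \<gamma> i" for i using h by (auto simp: \<gamma>_def)
    \<comment> \<open>The minimiser \<open>j\<close> leaves the support, so the induction measure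
      drops.\<close>
    have "{i. 0 < \<gamma> i} \<subset> {i. 0 < \<beta> i}"
      using j h by (fastforce simp: \<gamma>_def J_def split: if_splits)
    then have "card {i. 0 < \<gamma> i} < card {i. 0 < \<beta> i}"
      by (intro psubset_card_mono) auto
    then have "sum_of_squares (tensor_form m (\<lambda>is. Min (\<gamma> ` set is)))"
      using less.hyps nonneg by blast
    moreover have "sum_of_squares (\<lambda>x. h * (\<Sum>j\<in>J. x $ j) ^ m)"
      using h(1)[OF j(1)] \<open>even m\<close>
      by (intro sum_of_squares_cmult sum_of_squares_even_power real_polynomial_function_sum
          real_polynomial_function_nth) auto
    moreover have "Min (\<beta> ` set is) = Min (\<gamma> ` set is) + (if set is \<subseteq> J then h else 0)"
      if len: "length is = m" for "is"
    proof -
      \<comment> \<open>\<open>Min\<close> is meaningful only on nonempty sets.\<close>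
      have ne: "set is \<noteq> {}" using len \<open>0 < m\<close> by auto
      show ?thesis
      proof (cases "set is \<subseteq> J")
        case True
        then have "\<beta> ` set is = (\<lambda>i. \<gamma> i + h) ` set is"
          by (intro image_cong) (auto simp: \<gamma>_def)
        then show ?thesis
          using ne True by (simp add: Min_add_commute)
      next
        case False
        then obtain i where i: "i \<in> set is" "i \<notin> J" by blast
        \<comment> \<open>At an index outside \<open>J\<close> both \<open>\<beta>\<close> and
          \<open>\<gamma>\<close> take their least possible value \<open>0\<close>.\<close>
        have "Min (\<beta> ` set is) = 0"
          using i less.prems out by (intro Min_eqI) (auto simp: image_iff intro!: bexI[of _ i])
        moreover have "Min (\<gamma> ` set is) = 0"
          using i nonneg by (intro Min_eqI) (auto simp: image_iff \<gamma>_def h intro!: bexI[of _ i])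
        ultimately show ?thesis using False by simp
      qed
    qed
    then have "tensor_form m (\<lambda>is. Min (\<beta> ` set is))
        = tensor_form m (\<lambda>is. Min (\<gamma> ` set is) + (if set is \<subseteq> J then h else 0))"
      by (rule tensor_form_cong)
    then have "tensor_form m (\<lambda>is. Min (\<beta> ` set is))
        = (\<lambda>x. tensor_form m (\<lambda>is. Min (\<gamma> ` set is)) x + h * (\<Sum>j\<in>J. x $ j) ^ m)"
      by (simp add: fun_eq_iff tensor_form_add tensor_form_subset_indicator)
    ultimately show ?thesis
      by (simp add: sum_of_squares_add)
  qed
qed

section \<open>Splitting a B0-tensor\<close>

theorem theorem3p5:
  fixes A :: "'n::finite tensor" and m :: nat
  assumes "m > 0" and "even m"
    and "symmetric_tensor m A"
    and "B0_tensor m A"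
  shows "has_SOS_tensor_decomposition m A"
proof -
  define Off where "Off = (\<lambda>i::'n. {js. length js = m - 1 \<and> js \<noteq> replicate (m - 1) i})"
  \<comment> \<open>The inserted \<open>0\<close> makes \<open>\<beta>\<close> nonnegative and keeps
    \<open>Max\<close> meaningful when a row has no off-diagonal entry, as in dimension one.\<close>
  define \<beta> where "\<beta> = (\<lambda>i. Max (insert 0 ((\<lambda>js. A (i # js)) ` Off i)))"
  have fin: "finite (Off i)" for i
    by (rule finite_subset[OF _ finite_lists_of_length[of "m - 1"]]) (auto simp: Off_def)
  have nonneg: "0 \<le> \<beta> i" for i
    unfolding \<beta>_def using fin by (intro Max_ge) auto
  have entry: "A (i # js) \<le> \<beta> i" if "js \<in> Off i" for i js
    unfolding \<beta>_def using fin that by (intro Max_ge) auto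
  have row: "real CARD('n) ^ (m - 1) * \<beta> i \<le> row_sum m A i" for i
  proof -
    \<comment> \<open>Together the two B0 conditions say that the row mean bounds \<open>0\<close>
      and every off-diagonal entry of the row.\<close>
    have "b \<le> row_sum m A i / real CARD('n) ^ (m - 1)"
      if "b \<in> insert 0 ((\<lambda>js. A (i # js)) ` Off i)" for b
      using that assms(4) by (auto simp: B0_tensor_def Off_def)
    then have "\<beta> i \<le> row_sum m A i / real CARD('n) ^ (m - 1)"
      unfolding \<beta>_def using fin by (subst Max_le_iff) auto
    then show ?thesis by (simp add: field_simps)
  qed
  define N where "N = (\<lambda>is. Min (\<beta> ` set is))"
  define M where "M = (\<lambda>is. A is - N is)"
  have "sum_of_squares (tensor_form m M)"
  proof (rule sum_of_squares_Z_tensor[OF assms(1,2)])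
    show "symmetric_tensor m M"
      using assms(3) by (auto simp: symmetric_tensor_def M_def N_def)
  next
    fix i
    \<comment> \<open>Every entry of \<open>N\<close> in row \<open>i\<close> has \<open>i\<close>
      among its indices, so it is at most \<open>\<beta> i\<close>.\<close>
    have "(\<Sum>js | length js = m - 1. N (i # js)) \<le> (\<Sum>js | length (js :: 'n list) = m - 1. \<beta> i)"
      by (intro sum_mono) (auto simp: N_def intro: Min_le)
    also have "\<dots> = real CARD('n) ^ (m - 1) * \<beta> i"
      using card_lists_length_eq[of "UNIV :: 'n set" "m - 1"] by simp
    finally show "0 \<le> row_sum m M i"
      using row[of i] by (simp add: row_sum_def M_def sum_subtractf)
  next
    fix "is" :: "'n list" assume len: "length is = m" and nc: "\<And>i. is \<noteq> replicate m i"
    \<comment> \<open>Moving position \<open>k\<close> to the front displays \<open>A is\<close> as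
      an entry of row \<open>is ! k\<close>, off-diagonal because \<open>is\<close> is not constant.
      Ranging over \<open>k\<close> then bounds it by the minimum \<open>N is\<close>.\<close>
    have "A is \<le> \<beta> (is ! k)" if k: "k < m" for k
    proof -
      define js where "js = permute_list (Transposition.transpose 0 k) is"
      have perm: "Transposition.transpose 0 k permutes {..<length is}"
        using k len by (intro permutes_swap_id) auto
      have "length js = m" by (simp add: js_def len)
      moreover from this have "js \<noteq> []" using \<open>m > 0\<close> by auto
      ultimately have js: "length js = m" "js \<noteq> []" "js ! 0 = is ! k" "A js = A is" "set js = set is"
        using symmetric_tensor_first[OF assms(3) len k] len k perm unfolding js_def by auto
      have "tl js \<noteq> replicate (m - 1) (hd js)"
      proof
        assume "tl js = replicate (m - 1) (hd js)"
        then have "js = replicate m (hd js)"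
          using js(2) \<open>m > 0\<close> by (cases js; cases m) auto
        then have "set is \<subseteq> {hd js}"
          using js(5) by (metis set_replicate_conv_if empty_subsetI subset_refl)
        then have "is = replicate m (hd js)"
          using len by (auto intro!: replicate_eqI)
        then show False using nc by blast
      qed
      then have "A (hd js # tl js) \<le> \<beta> (hd js)"
        using js by (intro entry) (auto simp: Off_def)
      moreover have "hd js = is ! k" using js by (simp add: hd_conv_nth)
      ultimately show ?thesis using js by (metis hd_Cons_tl)
    qed
    then have "A is \<le> N is"
      unfolding N_def using len \<open>m > 0\<close> by (subst Min_ge_iff) (auto simp: in_set_conv_nth)
    then show "M is \<le> 0" by (simp add: M_def)
  qed
  moreover have "sum_of_squares (tensor_form m N)"
    unfolding N_def by (intro sum_of_squares_Min_tensor assms nonneg)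
  moreover have "tensor_form m A = (\<lambda>x. tensor_form m M x + tensor_form m N x)"
    by (simp add: M_def flip: tensor_form_add)
  ultimately show ?thesis
    by (simp add: has_SOS_tensor_decomposition_def sum_of_squares_add)
qed

end
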